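(* For a PCF program $P$ having type $\mathsf{int}$, we have $P\twoheadrightarrow_{\sf PCF}\underline n\iff P\twoheadrightarrow_{\mathtt{wh}}\underline n$.
   Context: $\twoheadrightarrow_{\sf PCF}$ is the reflexive-transitive closure of the call-by-name weak head reduction of PCF. EPCF extends PCF with (closed) explicit substitutions $M\langle x/N\rangle$; every PCF program is an EPCF program. $\to_{\mathtt{wh}}$ is the weak head reduction of EPCF: the union of computation steps ($\beta$-step $(\lambda x.M)^\sigma N\to M^\sigma\langle x/N\rangle$ where $\sigma$ is a list of explicit substitutions, and the usual $\mathbf{pred}$, $\mathbf{ifz}$, $\mathbf{fix}$ rules) and percolation steps pushing explicit substitutions inward (e.g. $x^\sigma\to\sigma(x)$, $(M N)^\sigma\to M^\sigma N^\sigma$), all under evaluation contexts; $\twoheadrightarrow_{\mathtt{wh}}$ is its reflexive-transitive closure. $\underline n=\mathbf{succ}^n(\mathbf0)$. *)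

theory Defs
  imports Main
begin

(* Terms are represented up to alpha-conversion by de Bruijn indices: Lam M binds index 0 of M,
   and ESub M N is the explicit substitution M<x/N>, which also binds index 0 (the variable x)
   of M, but not of N. *)
datatype trm =
    Var nat
  | App trm trm
  | Lam trm
  | Fix trm
  | Zero
  | Pred trm
  | Succ trm
  | Ifz trm trm trm
  | ESub trm trm

primrec fv :: "trm \<Rightarrow> nat set" where
  "fv (Var i) = {i}"
| "fv (App M N) = fv M \<union> fv N"
| "fv (Lam M) = Suc -` fv M"
| "fv (Fix M) = fv M"
| "fv Zero = {}"
| "fv (Pred M) = fv M"
| "fv (Succ M) = fv M"
| "fv (Ifz L M N) = fv L \<union> fv M \<union> fv N"
| "fv (ESub M N) = Suc -` fv M \<union> fv N"

abbreviation closed :: "trm \<Rightarrow> bool" where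
  "closed M \<equiv> fv M = {}"

(* EPCF terms: explicit substitutions are closed. *)
primrec epcf_term :: "trm \<Rightarrow> bool" where
  "epcf_term (Var i) = True"
| "epcf_term (App M N) = (epcf_term M \<and> epcf_term N)"
| "epcf_term (Lam M) = epcf_term M"
| "epcf_term (Fix M) = epcf_term M"
| "epcf_term Zero = True"
| "epcf_term (Pred M) = epcf_term M"
| "epcf_term (Succ M) = epcf_term M"
| "epcf_term (Ifz L M N) = (epcf_term L \<and> epcf_term M \<and> epcf_term N)"
| "epcf_term (ESub M N) = (epcf_term M \<and> epcf_term N \<and> closed N)"

(* PCF terms: no explicit substitutions. *)
primrec pcf_term :: "trm \<Rightarrow> bool" where
  "pcf_term (Var i) = True"
| "pcf_term (App M N) = (pcf_term M \<and> pcf_term N)"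
| "pcf_term (Lam M) = pcf_term M"
| "pcf_term (Fix M) = pcf_term M"
| "pcf_term Zero = True"
| "pcf_term (Pred M) = pcf_term M"
| "pcf_term (Succ M) = pcf_term M"
| "pcf_term (Ifz L M N) = (pcf_term L \<and> pcf_term M \<and> pcf_term N)"
| "pcf_term (ESub M N) = False"

definition epcf_program :: "trm \<Rightarrow> bool" where
  "epcf_program M \<longleftrightarrow> epcf_term M \<and> closed M"

definition pcf_program :: "trm \<Rightarrow> bool" where
  "pcf_program M \<longleftrightarrow> pcf_term M \<and> closed M"

lemma pcf_term_epcf_term: "pcf_term M \<Longrightarrow> epcf_term M"
  by (induction M) auto

lemma pcf_program_epcf_program: "pcf_program P \<Longrightarrow> epcf_program P"
  by (simp add: pcf_program_def epcf_program_def pcf_term_epcf_term)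

definition num :: "nat \<Rightarrow> trm" where
  "num n = (Succ ^^ n) Zero"


datatype ty = TInt | TFun ty ty

inductive typing :: "ty list \<Rightarrow> trm \<Rightarrow> ty \<Rightarrow> bool" where
  ty_var: "i < length \<Gamma> \<Longrightarrow> \<Gamma> ! i = A \<Longrightarrow> typing \<Gamma> (Var i) A"
| ty_app: "typing \<Gamma> M (TFun A B) \<Longrightarrow> typing \<Gamma> N A \<Longrightarrow> typing \<Gamma> (App M N) B"
| ty_lam: "typing (A # \<Gamma>) M B \<Longrightarrow> typing \<Gamma> (Lam M) (TFun A B)"
| ty_fix: "typing \<Gamma> M (TFun A A) \<Longrightarrow> typing \<Gamma> (Fix M) A"
| ty_zero: "typing \<Gamma> Zero TInt"
| ty_pred: "typing \<Gamma> M TInt \<Longrightarrow> typing \<Gamma> (Pred M) TInt"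
| ty_succ: "typing \<Gamma> M TInt \<Longrightarrow> typing \<Gamma> (Succ M) TInt"
| ty_ifz: "typing \<Gamma> L TInt \<Longrightarrow> typing \<Gamma> M A \<Longrightarrow> typing \<Gamma> N A \<Longrightarrow> typing \<Gamma> (Ifz L M N) A"
| ty_esub: "typing (B # \<Gamma>) M A \<Longrightarrow> typing [] N B \<Longrightarrow> typing \<Gamma> (ESub M N) A"


definition up_ren :: "(nat \<Rightarrow> nat) \<Rightarrow> nat \<Rightarrow> nat" where
  "up_ren r i = (case i of 0 \<Rightarrow> 0 | Suc j \<Rightarrow> Suc (r j))"

primrec ren :: "(nat \<Rightarrow> nat) \<Rightarrow> trm \<Rightarrow> trm" where
  "ren r (Var i) = Var (r i)"
| "ren r (App M N) = App (ren r M) (ren r N)"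
| "ren r (Lam M) = Lam (ren (up_ren r) M)"
| "ren r (Fix M) = Fix (ren r M)"
| "ren r Zero = Zero"
| "ren r (Pred M) = Pred (ren r M)"
| "ren r (Succ M) = Succ (ren r M)"
| "ren r (Ifz L M N) = Ifz (ren r L) (ren r M) (ren r N)"
| "ren r (ESub M N) = ESub (ren (up_ren r) M) (ren r N)"

definition up_sub :: "(nat \<Rightarrow> trm) \<Rightarrow> nat \<Rightarrow> trm" where
  "up_sub s i = (case i of 0 \<Rightarrow> Var 0 | Suc j \<Rightarrow> ren Suc (s j))"

primrec psubst :: "(nat \<Rightarrow> trm) \<Rightarrow> trm \<Rightarrow> trm" where
  "psubst s (Var i) = s i"
| "psubst s (App M N) = App (psubst s M) (psubst s N)"
| "psubst s (Lam M) = Lam (psubst (up_sub s) M)"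
| "psubst s (Fix M) = Fix (psubst s M)"
| "psubst s Zero = Zero"
| "psubst s (Pred M) = Pred (psubst s M)"
| "psubst s (Succ M) = Succ (psubst s M)"
| "psubst s (Ifz L M N) = Ifz (psubst s L) (psubst s M) (psubst s N)"
| "psubst s (ESub M N) = ESub (psubst (up_sub s) M) (psubst s N)"

(* The capture-avoiding M[N/x], where x is index 0 of M. *)
definition subst0 :: "trm \<Rightarrow> trm \<Rightarrow> trm" where
  "subst0 M N = psubst (\<lambda>i. case i of 0 \<Rightarrow> N | Suc j \<Rightarrow> Var j) M"


datatype ectx = Hole | EApp ectx trm | EPred ectx | ESucc ectx | EIfz ectx trm trm

primrec plug :: "ectx \<Rightarrow> trm \<Rightarrow> trm" where
  "plug Hole R = R"
| "plug (EApp E N) R = App (plug E R) N"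
| "plug (EPred E) R = Pred (plug E R)"
| "plug (ESucc E) R = Succ (plug E R)"
| "plug (EIfz E M N) R = Ifz (plug E R) M N"

(* The contractions common to PCF and EPCF. *)
inductive const_contr :: "trm \<Rightarrow> trm \<Rightarrow> bool" where
  pred_zero: "const_contr (Pred Zero) Zero"
| pred_succ: "const_contr (Pred (Succ (num n))) (num n)"
| ifz_zero: "const_contr (Ifz Zero M N) M"
| ifz_succ: "const_contr (Ifz (Succ (num n)) M N) N"
| fix_unfold: "const_contr (Fix M) (App M (Fix M))"

inductive pcf_contr :: "trm \<Rightarrow> trm \<Rightarrow> bool" where
  pcf_beta: "pcf_contr (App (Lam M) N) (subst0 M N)"
| pcf_const: "const_contr M N \<Longrightarrow> pcf_contr M N"

inductive pcf_step :: "trm \<Rightarrow> trm \<Rightarrow> bool" where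
  "pcf_contr R R' \<Longrightarrow> pcf_program (plug E R) \<Longrightarrow> pcf_step (plug E R) (plug E R')"


(* For \<sigma> = [N_1, ..., N_n], this is M^\<sigma> = M<x_1/N_1>...<x_n/N_n>, with the innermost
   substitution first; hence index i < n of M is the variable to which \<sigma> assigns \<sigma> ! i. *)
definition esubs :: "trm \<Rightarrow> trm list \<Rightarrow> trm" where
  "esubs M \<sigma> = foldl ESub M \<sigma>"

(* Computation steps. In (\<lambda>x.M)^\<sigma> the variable x is the innermost binder around M (index 0),
   and dom \<sigma> has the indices 1, ..., n, where n = length \<sigma>. In M^\<sigma><x/N> the binder of x lies
   outside those of \<sigma>, so that x gets index n, and dom \<sigma> gets the indices 0, ..., n - 1.
   Larger indices are unchanged. *)
definition out_ren :: "nat \<Rightarrow> nat \<Rightarrow> nat" where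
  "out_ren n i = (if i = 0 then n else if i \<le> n then i - 1 else i)"

inductive comp_contr :: "trm \<Rightarrow> trm \<Rightarrow> bool" where
  comp_beta: "comp_contr (App (esubs (Lam M) \<sigma>) N) (ESub (esubs (ren (out_ren (length \<sigma>)) M) \<sigma>) N)"
| comp_const: "const_contr M N \<Longrightarrow> comp_contr M N"

(* Percolation steps. The case of a variable outside dom \<sigma> does not arise in programs. *)
inductive perc_contr :: "trm \<Rightarrow> trm \<Rightarrow> bool" where
  perc_var: "i < length \<sigma> \<Longrightarrow> perc_contr (esubs (Var i) \<sigma>) (\<sigma> ! i)"
| perc_app: "\<sigma> \<noteq> [] \<Longrightarrow> perc_contr (esubs (App M N) \<sigma>) (App (esubs M \<sigma>) (esubs N \<sigma>))"
| perc_fix: "\<sigma> \<noteq> [] \<Longrightarrow> perc_contr (esubs (Fix M) \<sigma>) (Fix (esubs M \<sigma>))"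
| perc_zero: "\<sigma> \<noteq> [] \<Longrightarrow> perc_contr (esubs Zero \<sigma>) Zero"
| perc_pred: "\<sigma> \<noteq> [] \<Longrightarrow> perc_contr (esubs (Pred M) \<sigma>) (Pred (esubs M \<sigma>))"
| perc_succ: "\<sigma> \<noteq> [] \<Longrightarrow> perc_contr (esubs (Succ M) \<sigma>) (Succ (esubs M \<sigma>))"
| perc_ifz: "\<sigma> \<noteq> [] \<Longrightarrow> perc_contr (esubs (Ifz L M N) \<sigma>)
                               (Ifz (esubs L \<sigma>) (esubs M \<sigma>) (esubs N \<sigma>))"

inductive wh_step :: "trm \<Rightarrow> trm \<Rightarrow> bool" where
  wh_comp: "comp_contr R R' \<Longrightarrow> epcf_program (plug E R) \<Longrightarrow> wh_step (plug E R) (plug E R')"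
| wh_perc: "perc_contr R R' \<Longrightarrow> epcf_program (plug E R) \<Longrightarrow> wh_step (plug E R) (plug E R')"

end

theory Submission
  imports Defs
begin

text \<open>
  Carrying out all explicit substitutions maps EPCF terms to PCF terms. Under this unfolding
  a percolation step becomes an identity and a computation step becomes a PCF step. Conversely,
  percolation at the root terminates (each variable lookup moves to a proper subterm), so every
  EPCF program reduces to one whose root constructor is that of its unfolding, up to explicit
  substitutions around an abstraction. Hence each PCF step of the unfolding can be lifted.
\<close>

section \<open>Calculus of renamings and parallel substitutions, and their free variables\<close>

lemma up_ren_simps [simp]: "up_ren r 0 = 0" "up_ren r (Suc j) = Suc (r j)"
  by (simp_all add: up_ren_def)

lemma up_sub_simps [simp]: "up_sub s 0 = Var 0" "up_sub s (Suc j) = ren Suc (s j)"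
  by (simp_all add: up_sub_def)

lemma up_ren_comp: "up_ren r \<circ> up_ren q = up_ren (r \<circ> q)"
  by (rule ext) (auto simp: up_ren_def split: nat.split)

lemma ren_ren: "ren r (ren q M) = ren (r \<circ> q) M"
  by (induction M arbitrary: r q) (simp_all add: up_ren_comp)

lemma up_sub_comp_up_ren: "up_sub s \<circ> up_ren r = up_sub (s \<circ> r)"
  by (rule ext) (auto simp: up_ren_def up_sub_def split: nat.split)

lemma psubst_ren: "psubst s (ren r M) = psubst (s \<circ> r) M"
  by (induction M arbitrary: s r) (simp_all add: up_sub_comp_up_ren)

lemma ren_up_comp_up_sub: "ren (up_ren r) \<circ> up_sub s = up_sub (ren r \<circ> s)"
  by (rule ext) (auto simp: up_sub_def ren_ren comp_def split: nat.split)

lemma ren_psubst: "ren r (psubst s M) = psubst (ren r \<circ> s) M"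
  by (induction M arbitrary: s r) (simp_all add: ren_up_comp_up_sub)

lemma psubst_up_comp_up_sub: "psubst (up_sub t) \<circ> up_sub s = up_sub (psubst t \<circ> s)"
  by (rule ext) (auto simp: up_sub_def ren_psubst psubst_ren comp_def split: nat.split)

lemma psubst_psubst: "psubst t (psubst s M) = psubst (psubst t \<circ> s) M"
  by (induction M arbitrary: s t) (simp_all add: psubst_up_comp_up_sub)

lemma psubst_cong: "(\<And>i. i \<in> fv M \<Longrightarrow> s i = t i) \<Longrightarrow> psubst s M = psubst t M"
proof (induction M arbitrary: s t)
  case (Lam M)
  have "psubst (up_sub s) M = psubst (up_sub t) M"
    by (rule Lam.IH) (use Lam.prems in \<open>auto simp: up_sub_def split: nat.split\<close>)
  then show ?case by simp
next
  case (ESub M N)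
  have "psubst (up_sub s) M = psubst (up_sub t) M"
    by (rule ESub.IH) (use ESub.prems in \<open>auto simp: up_sub_def split: nat.split\<close>)
  moreover have "psubst s N = psubst t N"
    by (rule ESub.IH) (use ESub.prems in auto)
  ultimately show ?case by simp
next
  case (App M N)
  have "psubst s M = psubst t M" "psubst s N = psubst t N"
    by (rule App.IH; use App.prems in auto)+
  then show ?case by simp
next
  case (Ifz L M N)
  have "psubst s L = psubst t L" "psubst s M = psubst t M" "psubst s N = psubst t N"
    by (rule Ifz.IH; use Ifz.prems in auto)+
  then show ?case by simp
qed (metis psubst.simps fv.simps singletonI)+

lemma up_sub_Var: "up_sub Var = Var"
  by (rule ext) (auto simp: up_sub_def split: nat.split)

lemma psubst_Var: "psubst Var M = M"
  by (induction M) (simp_all add: up_sub_Var)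

text \<open>Any substitution agrees with the identity \<open>Var\<close> on an empty set of free
  variables. This is how closedness of explicit substitutions enters: their contents survive every
  further substitution unchanged.\<close>

lemma psubst_closed: "closed M \<Longrightarrow> psubst s M = M"
  using psubst_cong[of M s Var] by (simp add: psubst_Var)

lemma Suc_vimage_up_ren: "Suc -` up_ren r ` A = r ` Suc -` A"
proof (rule set_eqI)
  fix j
  have "(\<exists>i\<in>A. Suc j = up_ren r i) \<longleftrightarrow> (\<exists>i. Suc i \<in> A \<and> j = r i)"
    by (metis Suc_inject nat.distinct(1) not0_implies_Suc up_ren_simps)
  then show "j \<in> Suc -` up_ren r ` A \<longleftrightarrow> j \<in> r ` Suc -` A"
    by auto
qed

lemma fv_ren: "fv (ren r M) = r ` fv M"
  by (induction M arbitrary: r) (auto simp: Suc_vimage_up_ren)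

lemma Suc_vimage_fv_up_sub: "Suc -` (\<Union>i\<in>A. fv (up_sub s i)) = (\<Union>i\<in>Suc -` A. fv (s i))"
proof (rule set_eqI)
  fix j
  have "Suc j \<in> fv (up_sub s i) \<longleftrightarrow> (\<exists>k. i = Suc k \<and> j \<in> fv (s k))" for i
    by (cases i) (auto simp: fv_ren)
  then show "j \<in> Suc -` (\<Union>i\<in>A. fv (up_sub s i)) \<longleftrightarrow> j \<in> (\<Union>i\<in>Suc -` A. fv (s i))"
    by auto
qed

lemma fv_psubst: "fv (psubst s M) = (\<Union>i\<in>fv M. fv (s i))"
  by (induction M arbitrary: s) (simp_all add: Suc_vimage_fv_up_sub)

lemma fv_subst0: "fv (subst0 M N) \<subseteq> Suc -` fv M \<union> fv N"
  by (auto simp: subst0_def fv_psubst split: nat.splits)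

lemma ren_subst0: "ren r (subst0 M N) = subst0 (ren (up_ren r) M) (ren r N)"
  by (auto simp: subst0_def ren_psubst psubst_ren up_ren_def
      intro!: psubst_cong split: nat.split)

lemma pcf_term_ren: "pcf_term (ren r M) = pcf_term M"
  by (induction M arbitrary: r) simp_all

lemma pcf_term_psubst: "pcf_term M \<Longrightarrow> (\<And>i. pcf_term (s i)) \<Longrightarrow> pcf_term (psubst s M)"
  by (induction M arbitrary: s) (auto simp: up_sub_def pcf_term_ren split: nat.split)

lemma epcf_term_ren: "epcf_term M \<Longrightarrow> epcf_term (ren r M)"
  by (induction M arbitrary: r) (simp_all add: fv_ren)

section \<open>Unfolding explicit substitutions\<close>

primrec unf :: "trm \<Rightarrow> trm" where
  "unf (Var i) = Var i"
| "unf (App M N) = App (unf M) (unf N)"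
| "unf (Lam M) = Lam (unf M)"
| "unf (Fix M) = Fix (unf M)"
| "unf Zero = Zero"
| "unf (Pred M) = Pred (unf M)"
| "unf (Succ M) = Succ (unf M)"
| "unf (Ifz L M N) = Ifz (unf L) (unf M) (unf N)"
| "unf (ESub M N) = subst0 (unf M) (unf N)"

lemma unf_pcf_term: "pcf_term M \<Longrightarrow> unf M = M"
  by (induction M) auto

lemma num_simps [simp]: "num 0 = Zero" "num (Suc n) = Succ (num n)"
  by (simp_all add: num_def)

lemma pcf_term_num: "pcf_term (num n)"
  by (induction n) auto

lemma unf_num [simp]: "unf (num n) = num n"
  by (simp add: unf_pcf_term pcf_term_num)

lemma unf_ren: "unf (ren r M) = ren r (unf M)"
  by (induction M arbitrary: r) (simp_all add: ren_subst0)

lemma pcf_term_unf: "pcf_term (unf M)"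
  by (induction M) (auto simp: subst0_def intro!: pcf_term_psubst split: nat.split)

lemma fv_unf: "fv (unf M) \<subseteq> fv M"
proof (induction M)
  case (ESub M N)
  then show ?case using fv_subst0[of "unf M" "unf N"] by auto
qed auto

lemma pcf_program_unf: "epcf_program M \<Longrightarrow> pcf_program (unf M)"
  using fv_unf[of M] by (auto simp: pcf_program_def epcf_program_def pcf_term_unf)

section \<open>Lists of explicit substitutions as one parallel substitution\<close>

lemma esubs_Nil [simp]: "esubs M [] = M"
  by (simp add: esubs_def)

lemma esubs_snoc [simp]: "esubs M (\<sigma> @ [N]) = ESub (esubs M \<sigma>) N"
  by (simp add: esubs_def)

text \<open>Stripping all outer explicit substitutions reaches a head \<open>K\<close> of another
  shape. The outermost substitution is the last list entry, so the induction extends \<sigma> at its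
  end; for the same reason later inductions on \<sigma> use \<open>rev_induct\<close>.\<close>

lemma esubs_cases:
  obtains K \<sigma> where "M = esubs K \<sigma>" "\<And>A B. K \<noteq> ESub A B"
proof -
  have nil: "\<exists>K \<sigma>. L = esubs K \<sigma> \<and> (\<forall>A B. K \<noteq> ESub A B)"
    if "\<forall>A B. L \<noteq> ESub A B" for L
    using that by (metis esubs_Nil)
  have "\<exists>K \<sigma>. M = esubs K \<sigma> \<and> (\<forall>A B. K \<noteq> ESub A B)"
  proof (induction M)
    case (ESub M N)
    then show ?case by (metis esubs_snoc)
  qed (rule nil, simp)+
  then show ?thesis using that by blast
qed

lemma epcf_term_esubs:
  "epcf_term (esubs M \<sigma>) \<longleftrightarrow> epcf_term M \<and> (\<forall>N\<in>set \<sigma>. epcf_program N)"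
  by (induction \<sigma> rule: rev_induct) (auto simp: epcf_program_def)

text \<open>Each closed substitution binds index 0, lowers the remaining indices by one and adds no
  free variable.\<close>

lemma fv_esubs:
  "\<forall>N\<in>set \<sigma>. epcf_program N \<Longrightarrow> fv (esubs M \<sigma>) = {i. i + length \<sigma> \<in> fv M}"
  by (induction \<sigma> rule: rev_induct) (auto simp: epcf_program_def)

lemma epcf_program_esubs:
  "epcf_program (esubs M \<sigma>) \<longleftrightarrow>
     epcf_term M \<and> (\<forall>N\<in>set \<sigma>. epcf_program N) \<and> (\<forall>i\<in>fv M. i < length \<sigma>)"
proof -
  have "{i. i + length \<sigma> \<in> fv M} = {} \<longleftrightarrow> (\<forall>i\<in>fv M. i < length \<sigma>)"
    by (auto simp: not_less) (metis le_add_diff_inverse2 not_less)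
  then show ?thesis
    using epcf_term_esubs[of M \<sigma>] fv_esubs[of \<sigma> M] by (auto simp: epcf_program_def)
qed

text \<open>The parallel substitution that performs all of \<sigma> at once. Indices beyond the
  domain drop by \<open>length \<sigma>\<close>, because that many binders disappear.\<close>

definition unf_env :: "trm list \<Rightarrow> nat \<Rightarrow> trm" where
  "unf_env \<sigma> i = (if i < length \<sigma> then unf (\<sigma> ! i) else Var (i - length \<sigma>))"

lemma closed_unf: "epcf_program N \<Longrightarrow> closed (unf N)"
  using pcf_program_unf by (auto simp: pcf_program_def)

text \<open>Unfolding substitutes one entry after the other. This equals the simultaneous
  substitution because the unfolded entries are closed, so the outer substitutions cannot affect
  them.\<close>

lemma unf_esubs:
  "\<forall>N\<in>set \<sigma>. epcf_program N \<Longrightarrow> unf (esubs M \<sigma>) = psubst (unf_env \<sigma>) (unf M)"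
proof (induction \<sigma> rule: rev_induct)
  case Nil
  have "unf_env [] = Var" by (rule ext) (simp add: unf_env_def)
  then show ?case by (simp add: psubst_Var)
next
  case (snoc N \<sigma>)
  have "(psubst (case_nat (unf N) Var) \<circ> unf_env \<sigma>) i = unf_env (\<sigma> @ [N]) i" for i
  proof -
    \<comment> \<open>An index below \<open>length \<sigma>\<close> yields a closed entry, which the
      substitution for \<open>N\<close> fixes; the index \<open>length \<sigma>\<close> has become
      \<open>Var 0\<close> and receives \<open>unf N\<close>; a larger one loses one more
      binder.\<close>
    consider "i < length \<sigma>" | "i = length \<sigma>" | "i > length \<sigma>" by linarith
    then show ?thesis
    proof cases
      case 1
      then have "closed (unf (\<sigma> ! i))" using snoc.prems by (simp add: closed_unf)
      then show ?thesis using 1 by (simp add: unf_env_def nth_append psubst_closed)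
    next
      case 3
      then obtain k where "i = Suc (length \<sigma> + k)" using less_imp_Suc_add by blast
      then show ?thesis by (simp add: unf_env_def)
    qed (simp add: unf_env_def)
  qed
  then have "psubst (case_nat (unf N) Var) \<circ> unf_env \<sigma> = unf_env (\<sigma> @ [N])" by blast
  with snoc show ?case by (simp add: subst0_def psubst_psubst)
qed

section \<open>Weak head steps seen through the unfolding\<close>

text \<open>By \<open>unf_esubs\<close> both sides carry the same parallel substitution, which
  commutes with every constructor that percolates; for a variable it is the lookup itself.\<close>

lemma unf_perc: "perc_contr R R' \<Longrightarrow> epcf_program R \<Longrightarrow> unf R = unf R'"
proof (induction rule: perc_contr.induct)
  case (perc_var i \<sigma>)
  then show ?case by (simp add: epcf_program_esubs unf_esubs unf_env_def)
qed (simp_all add: epcf_program_esubs unf_esubs)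

text \<open>The redex unfolds to a PCF beta redex and the contractum to its PCF contractum. Moving
  the bound variable outside \<sigma> by \<open>out_ren\<close> is harmless since the entries of
  \<sigma> are closed and cannot capture or mention it.\<close>

lemma unf_beta:
  assumes "epcf_program (App (esubs (Lam M) \<sigma>) N)"
  shows "unf (ESub (esubs (ren (out_ren (length \<sigma>)) M) \<sigma>) N)
           = subst0 (psubst (up_sub (unf_env \<sigma>)) (unf M)) (unf N)"
    and "unf (App (esubs (Lam M) \<sigma>) N) = App (Lam (psubst (up_sub (unf_env \<sigma>)) (unf M))) (unf N)"
proof -
  have \<sigma>: "\<forall>L\<in>set \<sigma>. epcf_program L" and N: "epcf_program N"
    using assms epcf_term_esubs by (auto simp: epcf_program_def)
  \<comment> \<open>Index 0, the bound variable, is sent to position \<open>length \<sigma>\<close>,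
    where the extended list holds \<open>N\<close>. An index \<open>Suc j\<close> with
    \<open>j < length \<sigma>\<close> is sent to \<open>j\<close>, hence to the same entry of
    \<sigma>.\<close>
  have "unf_env (\<sigma> @ [N]) (out_ren (length \<sigma>) i)
      = psubst (case_nat (unf N) Var) (up_sub (unf_env \<sigma>) i)" for i
  proof (cases i)
    case (Suc j)
    then show ?thesis
      using \<sigma>
      by (auto simp: unf_env_def out_ren_def psubst_ren psubst_closed closed_unf nth_append)
  qed (simp add: unf_env_def out_ren_def)
  then have "unf_env (\<sigma> @ [N]) \<circ> out_ren (length \<sigma>)
      = psubst (case_nat (unf N) Var) \<circ> up_sub (unf_env \<sigma>)"
    by auto
  moreover have "unf (esubs (ren (out_ren (length \<sigma>)) M) (\<sigma> @ [N]))
      = psubst (unf_env (\<sigma> @ [N])) (ren (out_ren (length \<sigma>)) (unf M))"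
    using \<sigma> N by (subst unf_esubs) (auto simp: unf_ren)
  ultimately show "unf (ESub (esubs (ren (out_ren (length \<sigma>)) M) \<sigma>) N)
           = subst0 (psubst (up_sub (unf_env \<sigma>)) (unf M)) (unf N)"
    by (simp add: subst0_def psubst_ren psubst_psubst)
  show "unf (App (esubs (Lam M) \<sigma>) N) = App (Lam (psubst (up_sub (unf_env \<sigma>)) (unf M))) (unf N)"
    using \<sigma> by (simp add: unf_esubs)
qed

lemma unf_const: "const_contr R R' \<Longrightarrow> const_contr (unf R) (unf R')"
  by (induction rule: const_contr.induct) (auto intro: const_contr.intros)

lemma unf_comp: "comp_contr R R' \<Longrightarrow> epcf_program R \<Longrightarrow> pcf_contr (unf R) (unf R')"
proof (induction rule: comp_contr.induct)
  case (comp_beta M \<sigma> N)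
  then show ?case by (metis unf_beta pcf_beta)
next
  case (comp_const M N)
  then show ?case by (simp add: unf_const pcf_const)
qed

text \<open>The hole of an evaluation context lies under no binder and no explicit substitution, so
  the frames and the filling unfold separately. The witness is \<open>E\<close> with its side terms
  unfolded; its independence of \<open>R\<close> lets one \<open>E'\<close> serve both ends of a
  step.\<close>

lemma unf_plug: "\<exists>E'. \<forall>R. unf (plug E R) = plug E' (unf R)"
proof (induction E)
  case Hole
  show ?case by (rule exI[of _ Hole]) simp
next
  case (EApp E N)
  then obtain E' where "\<forall>R. unf (plug E R) = plug E' (unf R)" by blast
  then show ?case by (intro exI[of _ "EApp E' (unf N)"]) simp
next
  case (EPred E)
  then obtain E' where "\<forall>R. unf (plug E R) = plug E' (unf R)" by blast
  then show ?case by (intro exI[of _ "EPred E'"]) simp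
next
  case (ESucc E)
  then obtain E' where "\<forall>R. unf (plug E R) = plug E' (unf R)" by blast
  then show ?case by (intro exI[of _ "ESucc E'"]) simp
next
  case (EIfz E M N)
  then obtain E' where "\<forall>R. unf (plug E R) = plug E' (unf R)" by blast
  then show ?case by (intro exI[of _ "EIfz E' (unf M) (unf N)"]) simp
qed

lemma epcf_program_plugD: "epcf_program (plug E R) \<Longrightarrow> epcf_program R"
  by (induction E) (auto simp: epcf_program_def)

lemma epcf_program_plug_replace:
  "epcf_program (plug E R) \<Longrightarrow> epcf_program R' \<Longrightarrow> epcf_program (plug E R')"
  by (induction E) (auto simp: epcf_program_def)

text \<open>A computation step becomes exactly one PCF step and a percolation step becomes none,
  hence the closure in the conclusion.\<close>

lemma wh_step_unf: "wh_step M M' \<Longrightarrow> pcf_step\<^sup>*\<^sup>* (unf M) (unf M')"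
proof (induction rule: wh_step.induct)
  case (wh_comp R R' E)
  obtain E' where E': "\<forall>R. unf (plug E R) = plug E' (unf R)" using unf_plug by blast
  have "pcf_contr (unf R) (unf R')"
    using wh_comp epcf_program_plugD unf_comp by blast
  moreover have "pcf_program (plug E' (unf R))"
    using pcf_program_unf[OF wh_comp(2)] E' by simp
  ultimately show ?case using E' by (auto intro: pcf_step.intros)
next
  case (wh_perc R R' E)
  obtain E' where E': "\<forall>R. unf (plug E R) = plug E' (unf R)" using unf_plug by blast
  have "unf R = unf R'" using wh_perc epcf_program_plugD unf_perc by blast
  then show ?case using E' by simp
qed

lemma wh_steps_unf: "wh_step\<^sup>*\<^sup>* M M' \<Longrightarrow> pcf_step\<^sup>*\<^sup>* (unf M) (unf M')"
  by (induction rule: rtranclp_induct) (auto dest: wh_step_unf)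

section \<open>Lifting PCF steps along the unfolding\<close>

lemma epcf_program_perc: "perc_contr R R' \<Longrightarrow> epcf_program R \<Longrightarrow> epcf_program R'"
proof (induction rule: perc_contr.induct)
  case (perc_var i \<sigma>)
  then show ?case by (simp add: epcf_program_esubs)
qed (fastforce simp: epcf_program_def fv_esubs epcf_term_esubs)+

lemma epcf_program_comp: "comp_contr R R' \<Longrightarrow> epcf_program R \<Longrightarrow> epcf_program R'"
proof (induction rule: comp_contr.induct)
  case (comp_beta M \<sigma> N)
  then have N: "epcf_program N" and "epcf_program (esubs (Lam M) \<sigma>)"
    by (auto simp: epcf_program_def)
  then have L: "epcf_term M" "\<forall>L\<in>set \<sigma>. epcf_program L" "\<forall>i. Suc i \<in> fv M \<longrightarrow> i < length \<sigma>"
    by (auto simp: epcf_program_esubs)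
  \<comment> \<open>The renamed body has all its free indices within the domain of the extended list
    \<open>\<sigma> @ [N]\<close>, so the contractum is closed.\<close>
  have "out_ren (length \<sigma>) i < Suc (length \<sigma>)" if "i \<in> fv M" for i
    using L(3) that by (cases i) (auto simp: out_ren_def)
  then have "epcf_program (esubs (ren (out_ren (length \<sigma>)) M) (\<sigma> @ [N]))"
    using L N by (subst epcf_program_esubs) (auto simp: epcf_term_ren fv_ren)
  then show ?case by simp
next
  case (comp_const M N)
  then show ?case
    by (induction rule: const_contr.induct) (auto simp: epcf_program_def)
qed

lemma epcf_program_wh_step: "wh_step M M' \<Longrightarrow> epcf_program M'"
  by (induction rule: wh_step.induct)
     (meson epcf_program_comp epcf_program_perc epcf_program_plugD epcf_program_plug_replace)+

lemma epcf_program_wh_steps: "wh_step\<^sup>*\<^sup>* M M' \<Longrightarrow> epcf_program M \<Longrightarrow> epcf_program M'"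
  by (induction rule: rtranclp_induct) (auto dest: epcf_program_wh_step)

text \<open>A redex inside \<open>F\<close> inside \<open>E\<close> is a redex inside one context;
  this makes \<open>wh_step\<close> closed under evaluation contexts.\<close>

primrec ectx_comp :: "ectx \<Rightarrow> ectx \<Rightarrow> ectx" where
  "ectx_comp Hole F = F"
| "ectx_comp (EApp E N) F = EApp (ectx_comp E F) N"
| "ectx_comp (EPred E) F = EPred (ectx_comp E F)"
| "ectx_comp (ESucc E) F = ESucc (ectx_comp E F)"
| "ectx_comp (EIfz E M N) F = EIfz (ectx_comp E F) M N"

lemma plug_ectx_comp: "plug (ectx_comp E F) R = plug E (plug F R)"
  by (induction E) simp_all

lemma wh_step_plug:
  assumes "wh_step M M'" "epcf_program (plug E M)"
  shows "wh_step (plug E M) (plug E M')"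
  using assms
proof (induction rule: wh_step.induct)
  case (wh_comp R R' F)
  then show ?case using wh_step.wh_comp[of R R' "ectx_comp E F"] by (simp add: plug_ectx_comp)
next
  case (wh_perc R R' F)
  then show ?case using wh_step.wh_perc[of R R' "ectx_comp E F"] by (simp add: plug_ectx_comp)
qed

lemma wh_steps_plug:
  assumes "wh_step\<^sup>*\<^sup>* M M'" "epcf_program (plug E M)"
  shows "wh_step\<^sup>*\<^sup>* (plug E M) (plug E M')"
  using assms
proof (induction rule: rtranclp_induct)
  case (step M' M'')
  then have "epcf_program (plug E M')"
    by (meson epcf_program_plugD epcf_program_plug_replace epcf_program_wh_steps)
  with step show ?case by (meson rtranclp.rtrancl_into_rtrancl wh_step_plug)
qed simp

section \<open>Exposing the root constructor by percolation\<close>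

text \<open>No percolation rule enters an abstraction, so an abstraction keeps its explicit
  substitutions; the second disjunct with empty \<sigma> covers a bare \<open>Lam\<close>.\<close>

definition exposed :: "trm \<Rightarrow> bool" where
  "exposed M \<longleftrightarrow> (\<forall>A B. M \<noteq> ESub A B) \<and> (\<forall>L. M \<noteq> Lam L) \<or> (\<exists>K \<sigma>. M = esubs (Lam K) \<sigma>)"

text \<open>Entries are proper subterms. This is the termination measure for variable lookup, the
  only percolation whose result may itself need further percolation.\<close>

lemma size_nth_esubs: "i < length \<sigma> \<Longrightarrow> size (\<sigma> ! i) < size (esubs M \<sigma>)"
  by (induction \<sigma> rule: rev_induct) (auto simp: nth_append less_Suc_eq)

text \<open>With \<open>M\<close> split into a head \<open>K\<close> under \<sigma>, the shape of
  \<open>K\<close> selects the percolation rule. Percolations leave the unfolding unchanged, and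
  induction on size handles chains of lookups.\<close>

lemma wh_steps_exposed:
  "epcf_program M \<Longrightarrow> \<exists>M'. wh_step\<^sup>*\<^sup>* M M' \<and> exposed M' \<and> unf M' = unf M"
proof (induction M rule: measure_induct_rule[of size])
  case (less M)
  obtain K \<sigma> where M: "M = esubs K \<sigma>" and K: "\<And>A B. K \<noteq> ESub A B"
    using esubs_cases by blast
  have root: "wh_step M M'" if "perc_contr M M'" for M'
    using wh_perc[OF that, of Hole] less.prems by simp
  \<comment> \<open>Every rule except lookup puts a constructor other than \<open>ESub\<close> and
    \<open>Lam\<close> at the root, so a single step suffices.\<close>
  have perc: ?case if "perc_contr M M'" "\<And>A B. M' \<noteq> ESub A B" "\<And>L. M' \<noteq> Lam L" for M'
    using root[OF that(1)] unf_perc[OF that(1) less.prems] that(2,3)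
    by (auto simp: exposed_def)
  show ?case
  proof (cases "\<sigma> = [] \<or> (\<exists>L. K = Lam L)")
    case True
    then have "exposed M" using M K by (cases "\<exists>L. K = Lam L") (auto simp: exposed_def)
    then show ?thesis by blast
  next
    case False
    then have \<sigma>: "\<sigma> \<noteq> []" and noLam: "\<And>L. K \<noteq> Lam L" by auto
    show ?thesis
    proof (cases K)
      case (Var i)
      \<comment> \<open>Closedness of \<open>M\<close> forces the variable into the domain of
        \<sigma>. The entry found may again carry substitutions, hence the induction
        hypothesis.\<close>
      then have i: "i < length \<sigma>" and prog: "epcf_program (\<sigma> ! i)"
        using less.prems M by (auto simp: epcf_program_esubs)
      have c: "perc_contr M (\<sigma> ! i)" using M Var i by (simp add: perc_var)
      obtain M' where "wh_step\<^sup>*\<^sup>* (\<sigma> ! i) M'" "exposed M'" "unf M' = unf (\<sigma> ! i)"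
        using less.IH[of "\<sigma> ! i"] prog size_nth_esubs[OF i] M by blast
      then show ?thesis
        using root[OF c] unf_perc[OF c less.prems]
        by (metis converse_rtranclp_into_rtranclp)
    next
      case (App A B) show ?thesis by (rule perc) (use M App \<sigma> perc_app in auto)
    next
      case (Fix A) show ?thesis by (rule perc) (use M Fix \<sigma> perc_fix in auto)
    next
      case Zero show ?thesis by (rule perc) (use M Zero \<sigma> perc_zero in auto)
    next
      case (Pred A) show ?thesis by (rule perc) (use M Pred \<sigma> perc_pred in auto)
    next
      case (Succ A) show ?thesis by (rule perc) (use M Succ \<sigma> perc_succ in auto)
    next
      case (Ifz A B C) show ?thesis by (rule perc) (use M Ifz \<sigma> perc_ifz in auto)
    qed (use K noLam in auto)
  qed
qed

lemma unf_esubs_Lam: "\<exists>L. unf (esubs (Lam K) \<sigma>) = Lam L"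
  by (induction \<sigma> rule: rev_induct) (auto simp: subst0_def)

lemma exposed_cases:
  assumes "exposed M"
  shows "(\<exists>K \<sigma>. M = esubs (Lam K) \<sigma>) \<and> (\<exists>L. unf M = Lam L)
    \<or> (\<forall>A B. M \<noteq> ESub A B) \<and> (\<forall>L. M \<noteq> Lam L)"
  using assms unfolding exposed_def by (metis unf_esubs_Lam)

text \<open>Outside \<open>ESub\<close>, unfolding preserves the root constructor, and an
  abstraction under substitutions unfolds to an abstraction. Thus the root of an exposed term can be
  read off its unfolding.\<close>

lemma exposed_unfD:
  assumes "exposed M"
  shows "unf M = App A B \<Longrightarrow> \<exists>A' B'. M = App A' B' \<and> unf A' = A \<and> unf B' = B"
    and "unf M = Lam A \<Longrightarrow> \<exists>K \<sigma>. M = esubs (Lam K) \<sigma>"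
    and "unf M = Fix A \<Longrightarrow> \<exists>A'. M = Fix A' \<and> unf A' = A"
    and "unf M = Zero \<Longrightarrow> M = Zero"
    and "unf M = Pred A \<Longrightarrow> \<exists>A'. M = Pred A' \<and> unf A' = A"
    and "unf M = Succ A \<Longrightarrow> \<exists>A'. M = Succ A' \<and> unf A' = A"
    and "unf M = Ifz A B C \<Longrightarrow> \<exists>A' B' C'. M = Ifz A' B' C' \<and> unf A' = A \<and> unf B' = B \<and> unf C' = C"
  by (cases M; use exposed_cases[OF assms] in simp)+

text \<open>A term that unfolds to a numeral may still hide it under substitutions. Since
  \<open>ESucc\<close> is an evaluation context, the successors can be exposed one at a
  time.\<close>

lemma wh_steps_num: "epcf_program M \<Longrightarrow> unf M = num n \<Longrightarrow> wh_step\<^sup>*\<^sup>* M (num n)"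
proof (induction n arbitrary: M)
  case 0
  then show ?case using wh_steps_exposed[of M] exposed_unfD(4) by fastforce
next
  case (Suc n)
  obtain M' where M': "wh_step\<^sup>*\<^sup>* M M'" "exposed M'" "unf M' = Succ (num n)"
    using wh_steps_exposed[OF Suc.prems(1)] Suc.prems(2) by auto
  obtain A where A: "M' = Succ A" "unf A = num n"
    using exposed_unfD(6)[OF M'(2,3)] by blast
  have prog: "epcf_program (Succ A)" using epcf_program_wh_steps M' A Suc.prems by blast
  then have "wh_step\<^sup>*\<^sup>* A (num n)" using Suc.IH A by (auto simp: epcf_program_def)
  then have "wh_step\<^sup>*\<^sup>* M' (Succ (num n))"
    using wh_steps_plug[of A "num n" "ESucc Hole"] prog A by simp
  then show ?case using M' by simp
qed

section \<open>Lifting PCF contractions and reduction sequences\<close>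

text \<open>Exposure gives \<open>M\<close> the root constructor of the redex, but the argument
  being inspected only unfolds to the right shape. It is first reduced in place, to an abstraction
  under substitutions or to a literal numeral; then one computation step applies.\<close>

lemma lift_pcf_contr:
  assumes "pcf_contr R R'" "unf M = R" "epcf_program M" "exposed M"
  shows "\<exists>M'. wh_step\<^sup>*\<^sup>* M M' \<and> unf M' = R'"
proof -
  have finish: ?thesis if "wh_step\<^sup>*\<^sup>* M M1" "comp_contr M1 M2" "unf M2 = R'" for M1 M2
  proof -
    have "epcf_program M1" using that(1) assms(3) epcf_program_wh_steps by blast
    then have "wh_step M1 M2" using wh_comp[OF that(2), of Hole] by simp
    then show ?thesis using that by (blast intro: rtranclp.rtrancl_into_rtrancl)
  qed
  have num: "wh_step\<^sup>*\<^sup>* (plug E A) (plug E (num n))"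
    if "epcf_program (plug E A)" "unf A = num n" for E A n
    by (rule wh_steps_plug[OF wh_steps_num[OF epcf_program_plugD[OF that(1)] that(2)] that(1)])
  from assms(1) show ?thesis
  proof cases
    case (pcf_beta K N)
    obtain A B where M: "M = App A B" "unf A = Lam K" "unf B = N"
      using exposed_unfD(1)[OF assms(4)] assms(2) pcf_beta by blast
    obtain A' where A': "wh_step\<^sup>*\<^sup>* A A'" "exposed A'" "unf A' = Lam K"
      using wh_steps_exposed[of A] assms(3) M by (auto simp: epcf_program_def)
    obtain L \<sigma> where L: "A' = esubs (Lam L) \<sigma>" using exposed_unfD(2)[OF A'(2,3)] by blast
    have st: "wh_step\<^sup>*\<^sup>* M (App A' B)"
      using wh_steps_plug[OF A'(1), of "EApp Hole B"] assms(3) M by simp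
    then have "epcf_program (App (esubs (Lam L) \<sigma>) B)"
      using assms(3) epcf_program_wh_steps L by blast
    note u = unf_beta[OF this]
    \<comment> \<open>Both sides are the body of the abstraction to which \<open>A'\<close>
      unfolds.\<close>
    have "psubst (up_sub (unf_env \<sigma>)) (unf L) = K" using u(2) A' L by simp
    then have "unf (ESub (esubs (ren (out_ren (length \<sigma>)) L) \<sigma>) B) = R'"
      using u(1) M pcf_beta by simp
    then show ?thesis using finish st L comp_beta by blast
  next
    case pcf_const
    then show ?thesis
    proof cases
      case pred_zero
      then obtain A where M: "M = Pred A" "unf A = num 0"
        using exposed_unfD(5)[OF assms(4)] assms(2) by auto
      then show ?thesis
        using num[of "EPred Hole" A 0] assms(3) pred_zero
        by (intro finish[of "Pred Zero" Zero]) (auto intro: comp_const const_contr.intros)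
    next
      case (pred_succ n)
      then obtain A where M: "M = Pred A" "unf A = num (Suc n)"
        using exposed_unfD(5)[OF assms(4)] assms(2) by auto
      then show ?thesis
        using num[of "EPred Hole" A "Suc n"] assms(3) pred_succ
        by (intro finish[of "Pred (Succ (num n))" "num n"])
           (auto intro: comp_const const_contr.intros)
    next
      case (ifz_zero N)
      then obtain A B C where M: "M = Ifz A B C" "unf A = num 0" "unf B = R'"
        using exposed_unfD(7)[OF assms(4)] assms(2) by force
      then show ?thesis
        using num[of "EIfz Hole B C" A 0] assms(3)
        by (intro finish[of "Ifz Zero B C" B]) (auto intro: comp_const const_contr.intros)
    next
      case (ifz_succ n N)
      then obtain A B C where M: "M = Ifz A B C" "unf A = num (Suc n)" "unf C = R'"
        using exposed_unfD(7)[OF assms(4)] assms(2) by force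
      then show ?thesis
        using num[of "EIfz Hole B C" A "Suc n"] assms(3)
        by (intro finish[of "Ifz (Succ (num n)) B C" C])
           (auto intro: comp_const const_contr.intros)
    next
      case (fix_unfold K)
      then obtain A where M: "M = Fix A" "unf A = K"
        using exposed_unfD(3)[OF assms(4)] assms(2) by blast
      then show ?thesis
        using fix_unfold
        by (intro finish[of M "App A (Fix A)"]) (auto intro: comp_const const_contr.intros)
    qed
  qed
qed

text \<open>Substitutions may sit above any frame of \<open>E\<close> in \<open>M\<close>, so the
  path to the redex is uncovered layer by layer: expose the root, match it with the outermost frame,
  and recurse into its hole. Side terms agree with those of \<open>E\<close> only after
  unfolding.\<close>

lemma lift_plug:
  assumes "pcf_contr R R'" "unf M = plug E R" "epcf_program M"
  shows "\<exists>M'. wh_step\<^sup>*\<^sup>* M M' \<and> unf M' = plug E R'"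
  using assms(2,3)
proof (induction E arbitrary: M)
  case Hole
  obtain M' where M': "wh_step\<^sup>*\<^sup>* M M'" "exposed M'" "unf M' = R"
    using wh_steps_exposed[OF Hole(2)] Hole(1) by auto
  then have "\<exists>M''. wh_step\<^sup>*\<^sup>* M' M'' \<and> unf M'' = R'"
    using lift_pcf_contr[OF assms(1)] Hole epcf_program_wh_steps by blast
  then show ?case using M'(1) by (metis plug.simps(1) rtranclp_trans)
next
  case (EApp E N)
  obtain M' where M': "wh_step\<^sup>*\<^sup>* M M'" "exposed M'" "unf M' = App (plug E R) N"
    using wh_steps_exposed[OF EApp.prems(2)] EApp.prems(1) by auto
  obtain A B where A: "M' = App A B" "unf A = plug E R" "unf B = N"
    using exposed_unfD(1)[OF M'(2,3)] by blast
  have prog: "epcf_program (plug (EApp Hole B) A)"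
    using epcf_program_wh_steps[OF M'(1) EApp.prems(2)] A by simp
  obtain A' where "wh_step\<^sup>*\<^sup>* A A'" "unf A' = plug E R'"
    using EApp.IH[OF A(2) epcf_program_plugD[OF prog]] by blast
  with wh_steps_plug[OF _ prog] M'(1) A show ?case
    by (intro exI[of _ "App A' B"]) (auto intro: rtranclp_trans)
next
  case (EPred E)
  obtain M' where M': "wh_step\<^sup>*\<^sup>* M M'" "exposed M'" "unf M' = Pred (plug E R)"
    using wh_steps_exposed[OF EPred.prems(2)] EPred.prems(1) by auto
  obtain A where A: "M' = Pred A" "unf A = plug E R"
    using exposed_unfD(5)[OF M'(2,3)] by blast
  have prog: "epcf_program (plug (EPred Hole) A)"
    using epcf_program_wh_steps[OF M'(1) EPred.prems(2)] A by simp
  obtain A' where "wh_step\<^sup>*\<^sup>* A A'" "unf A' = plug E R'"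
    using EPred.IH[OF A(2) epcf_program_plugD[OF prog]] by blast
  with wh_steps_plug[OF _ prog] M'(1) A show ?case
    by (intro exI[of _ "Pred A'"]) (auto intro: rtranclp_trans)
next
  case (ESucc E)
  obtain M' where M': "wh_step\<^sup>*\<^sup>* M M'" "exposed M'" "unf M' = Succ (plug E R)"
    using wh_steps_exposed[OF ESucc.prems(2)] ESucc.prems(1) by auto
  obtain A where A: "M' = Succ A" "unf A = plug E R"
    using exposed_unfD(6)[OF M'(2,3)] by blast
  have prog: "epcf_program (plug (ESucc Hole) A)"
    using epcf_program_wh_steps[OF M'(1) ESucc.prems(2)] A by simp
  obtain A' where "wh_step\<^sup>*\<^sup>* A A'" "unf A' = plug E R'"
    using ESucc.IH[OF A(2) epcf_program_plugD[OF prog]] by blast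
  with wh_steps_plug[OF _ prog] M'(1) A show ?case
    by (intro exI[of _ "Succ A'"]) (auto intro: rtranclp_trans)
next
  case (EIfz E N L)
  obtain M' where M': "wh_step\<^sup>*\<^sup>* M M'" "exposed M'" "unf M' = Ifz (plug E R) N L"
    using wh_steps_exposed[OF EIfz.prems(2)] EIfz.prems(1) by auto
  obtain A B C where A: "M' = Ifz A B C" "unf A = plug E R" "unf B = N" "unf C = L"
    using exposed_unfD(7)[OF M'(2,3)] by blast
  have prog: "epcf_program (plug (EIfz Hole B C) A)"
    using epcf_program_wh_steps[OF M'(1) EIfz.prems(2)] A by simp
  obtain A' where "wh_step\<^sup>*\<^sup>* A A'" "unf A' = plug E R'"
    using EIfz.IH[OF A(2) epcf_program_plugD[OF prog]] by blast
  with wh_steps_plug[OF _ prog] M'(1) A show ?case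
    by (intro exI[of _ "Ifz A' B C"]) (auto intro: rtranclp_trans)
qed

lemma lift_pcf_steps:
  assumes "pcf_step\<^sup>*\<^sup>* (unf M) N" "epcf_program M"
  shows "\<exists>M'. wh_step\<^sup>*\<^sup>* M M' \<and> unf M' = N"
  using assms(1)
proof (induction rule: rtranclp_induct)
  case (step N N')
  then obtain M' where M': "wh_step\<^sup>*\<^sup>* M M'" "unf M' = N" by blast
  from step(2) show ?case
  proof cases
    case (1 R R' E)
    then obtain M'' where "wh_step\<^sup>*\<^sup>* M' M''" "unf M'' = N'"
      using lift_plug[of R R' M' E] M' epcf_program_wh_steps[OF M'(1) assms(2)] by blast
    then show ?thesis using M'(1) by (blast intro: rtranclp_trans)
  qed
qed blast

theorem theorem2p23:
  fixes P :: trm and n :: nat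
  assumes "pcf_program P" and "typing [] P TInt"
  shows "pcf_step\<^sup>*\<^sup>* P (num n) \<longleftrightarrow> wh_step\<^sup>*\<^sup>* P (num n)"
proof
  \<comment> \<open>A PCF program is its own unfolding, so both simulations start from
    \<open>P\<close> itself.\<close>
  have P: "epcf_program P" "unf P = P"
    using assms(1) by (simp_all add: pcf_program_epcf_program unf_pcf_term pcf_program_def)
  show "wh_step\<^sup>*\<^sup>* P (num n)" if steps: "pcf_step\<^sup>*\<^sup>* P (num n)"
  proof -
    obtain M where "wh_step\<^sup>*\<^sup>* P M" "unf M = num n"
      using lift_pcf_steps[of P "num n"] P steps by auto
    \<comment> \<open>The lifted reduction ends in a term that merely unfolds to the numeral;
      further percolations reach the numeral.\<close>
    then show ?thesis using wh_steps_num P(1) epcf_program_wh_steps rtranclp_trans by metis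
  qed
  show "pcf_step\<^sup>*\<^sup>* P (num n)" if "wh_step\<^sup>*\<^sup>* P (num n)"
    using wh_steps_unf[OF that] P(2) by simp
qed

end
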